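(* Let $E$ be a locally convex space and let $T:E\to E$ be a continuous linear weakly supercyclic operator. If $u\in E'$ is not a fixed point of $T'$ and it satisfies that $((T')^n(u))_n$ is weakly convergent to some (fixed point) $v\in E'$, then $v=0$.
   Context: $E$ is a complex locally convex space; $E'$ is its topological dual and $T':E'\to E'$ is the adjoint of $T$, $\langle T'u,e\rangle=\langle u,Te\rangle$ for $u\in E'$, $e\in E$. A fixed point of $T'$ is an element $x\in E'$ with $T'x=x$. $T$ is weakly supercyclic if there is $f\in E$ such that $\{\lambda T^n f:\lambda\in\mathbb{C},\ n=0,1,2,\dots\}$ is dense in $E$ for the weak topology $\sigma(E,E')$. Weakly convergent means convergent in the weak topology of $E'$. *)

theory Defs
  imports "HOL-Analysis.Analysis"
begin

text \<open>Complex locally convex spaces, not assumed to be Hausdorff. The real scalar multiplication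
  is the restriction of the complex one. The library's \<open>convex\<close> is not available inside the class
  specification, so the last axiom spells it out.\<close>

class complex_locally_convex_space = real_vector + topological_ab_group_add +
  fixes scaleC :: "complex \<Rightarrow> 'a \<Rightarrow> 'a"  (infixr "*\<^sub>C" 75)
  assumes scaleC_add_right: "a *\<^sub>C (x + y) = a *\<^sub>C x + a *\<^sub>C y"
    and scaleC_add_left: "(a + b) *\<^sub>C x = a *\<^sub>C x + b *\<^sub>C x"
    and scaleC_scaleC: "a *\<^sub>C (b *\<^sub>C x) = (a * b) *\<^sub>C x"
    and scaleC_one: "1 *\<^sub>C x = x"
    and scaleR_scaleC: "r *\<^sub>R x = complex_of_real r *\<^sub>C x"
    and tendsto_scaleC_Pair:
      "LIM p (nhds a \<times>\<^sub>F nhds x). fst p *\<^sub>C snd p :> nhds (a *\<^sub>C x)"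
    and locally_convex:
      "open U \<Longrightarrow> x \<in> U \<Longrightarrow> \<exists>V. open V \<and> x \<in> V \<and> V \<subseteq> U \<and>
        (\<forall>y\<in>V. \<forall>z\<in>V. \<forall>s\<ge>0. \<forall>t\<ge>0. s + t = 1 \<longrightarrow> s *\<^sub>R y + t *\<^sub>R z \<in> V)"

lemma locally_convex_convex:
  fixes U :: "'a::complex_locally_convex_space set"
  assumes "open U" "x \<in> U"
  shows "\<exists>V. open V \<and> x \<in> V \<and> V \<subseteq> U \<and> convex V"
  using locally_convex[OF assms] unfolding convex_def .

definition topological_dual :: "('a::complex_locally_convex_space \<Rightarrow> complex) set" where
  "topological_dual = {\<phi>. Vector_Spaces.linear scaleC (*) \<phi> \<and> continuous_on UNIV \<phi>}"

text \<open>The coarsest topology on \<open>X\<close> for which all members of the nonempty family \<open>F\<close> are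
  continuous (for empty \<open>F\<close> the underlying set would be empty instead of \<open>X\<close>).\<close>

definition initial_topology :: "'b set \<Rightarrow> ('b \<Rightarrow> 'c::topological_space) set \<Rightarrow> 'b topology" where
  "initial_topology X F = topology_generated_by {{x \<in> X. f x \<in> S} |f S. f \<in> F \<and> open S}"

text \<open>\<open>\<sigma>(E, E')\<close>\<close>

definition weak_topology :: "'a::complex_locally_convex_space topology" where
  "weak_topology = initial_topology UNIV topological_dual"

text \<open>\<open>\<sigma>(E', E)\<close>, with underlying set \<open>E'\<close>\<close>

definition dual_weak_topology :: "('a::complex_locally_convex_space \<Rightarrow> complex) topology" where
  "dual_weak_topology = initial_topology topological_dual {\<lambda>\<phi>. \<phi> e |e. True}"

text \<open>The adjoint \<open>T'\<close>; it maps \<open>E'\<close> to \<open>E'\<close> when \<open>T\<close> is linear and continuous.\<close>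

definition dual_map :: "('a \<Rightarrow> 'a) \<Rightarrow> ('a \<Rightarrow> complex) \<Rightarrow> 'a \<Rightarrow> complex" where
  "dual_map T u = (\<lambda>e. u (T e))"

definition weakly_supercyclic :: "('a::complex_locally_convex_space \<Rightarrow> 'a) \<Rightarrow> bool" where
  "weakly_supercyclic T \<longleftrightarrow>
    (\<exists>f. weak_topology closure_of {c *\<^sub>C (T ^^ n) f |c n. True} = UNIV)"

end

theory Submission imports Defs begin

text \<open>If \<open>f\<close> is a supercyclic vector, then \<open>(T')\<^sup>n u (f)\<close> is bounded and \<open>v (T\<^sup>n f) = v f\<close>, so
  \<open>v f \<noteq> 0\<close> (which holds unless \<open>v = 0\<close>) gives \<open>|u x| \<le> M |v x|\<close> on the projective orbit of \<open>f\<close>.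
  This inequality defines a weakly closed set, so it holds everywhere and \<open>ker v \<subseteq> ker u\<close>.
  Since \<open>v\<close> is fixed by \<open>T'\<close>, the range of \<open>T - I\<close> lies in \<open>ker v\<close>, hence in \<open>ker u\<close>, i.e.
  \<open>T' u = u\<close>.\<close>

lemma topspace_initial_topology:
  assumes "F \<noteq> {}"
  shows "topspace (initial_topology X F) = X"
  using assms unfolding initial_topology_def topology_generated_by_topspace by blast

lemma continuous_map_initial_topology:
  assumes "f \<in> F"
  shows "continuous_map (initial_topology X F) euclidean f"
proof -
  have "openin (initial_topology X F) {x \<in> X. f x \<in> S}" if "open S" for S
    unfolding initial_topology_def
    by (rule topology_generated_by_Basis) (use assms that in blast)
  moreover have "topspace (initial_topology X F) = X"
    using assms by (intro topspace_initial_topology) blast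
  ultimately show ?thesis
    by (auto simp: continuous_map)
qed

lemma continuous_map_weak_topology:
  assumes "\<phi> \<in> topological_dual"
  shows "continuous_map weak_topology euclidean \<phi>"
  unfolding weak_topology_def using assms by (rule continuous_map_initial_topology)

text \<open>Evaluation at \<open>e\<close> belongs to the family generating the topology, hence is
  continuous and preserves limits.\<close>

lemma tendsto_if_limitin_dual_weak_topology:
  assumes "limitin dual_weak_topology \<phi> v F"
  shows "((\<lambda>n. \<phi> n e) \<longlongrightarrow> v e) F"
proof -
  have "continuous_map dual_weak_topology euclidean (\<lambda>\<phi>. \<phi> e)"
    unfolding dual_weak_topology_def by (rule continuous_map_initial_topology) blast
  from continuous_map_limit[OF this assms] show ?thesis
    by (simp add: comp_def)
qed

lemma dual_map_funpow: "(dual_map T ^^ n) u e = u ((T ^^ n) e)"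
  by (induction n arbitrary: e) (simp_all add: dual_map_def flip: funpow_swap1)

lemma topological_dual_scaleC:
  assumes "\<phi> \<in> topological_dual"
  shows "\<phi> (c *\<^sub>C x) = c * \<phi> x"
  using assms by (simp add: topological_dual_def Vector_Spaces.linear_iff)

lemma topological_dual_diff:
  assumes "\<phi> \<in> topological_dual"
  shows "\<phi> (x - y) = \<phi> x - \<phi> y"
proof -
  have "\<phi> (a + b) = \<phi> a + \<phi> b" for a b
    using assms by (simp add: topological_dual_def Vector_Spaces.linear_iff)
  from this[of "x - y" y] show ?thesis
    by simp
qed

text \<open>The inequality cuts out the preimage of the closed half-line \<open>{0..}\<close> under
  a weakly continuous real function.\<close>

lemma norm_le_on_weakly_dense:
  assumes "u \<in> topological_dual" "v \<in> topological_dual"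
    and "weak_topology closure_of A = UNIV"
    and "\<And>x. x \<in> A \<Longrightarrow> norm (u x) \<le> M * norm (v x)"
  shows "norm (u x) \<le> M * norm (v x)"
proof -
  let ?g = "\<lambda>x. M * norm (v x) - norm (u x)"
  have "continuous_map weak_topology euclideanreal ?g"
    using assms(1,2)
    by (intro continuous_map_diff continuous_map_real_mult continuous_map_const[THEN iffD2]
        continuous_map_norm continuous_map_weak_topology) auto
  then have "closedin weak_topology {x \<in> topspace weak_topology. ?g x \<in> {0..}}"
    by (rule closedin_continuous_map_preimage) simp
  \<comment> \<open>A closure always lies in the underlying space, so density of \<open>A\<close>
    already gives this.\<close>
  moreover have "topspace (weak_topology :: 'a topology) = UNIV"
    using closure_of_subset_topspace[of weak_topology A] assms(3) by auto
  ultimately have "weak_topology closure_of A \<subseteq> {x. ?g x \<in> {0..}}"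
    using assms(4) by (intro closure_of_minimal) auto
  then show ?thesis
    using assms(3) by auto
qed

theorem theorem11:
  fixes T :: "'a::complex_locally_convex_space \<Rightarrow> 'a"
    and u v :: "'a \<Rightarrow> complex"
  assumes "Vector_Spaces.linear scaleC scaleC T"
    and "continuous_on UNIV T"
    and "weakly_supercyclic T"
    and "u \<in> topological_dual"
    and "dual_map T u \<noteq> u"
    and "v \<in> topological_dual"
    and "limitin dual_weak_topology (\<lambda>n. (dual_map T ^^ n) u) v sequentially"
  shows "v = (\<lambda>e. 0)"
proof (rule ccontr)
  assume v_nonzero: "v \<noteq> (\<lambda>e. 0)"
  obtain f where dense: "weak_topology closure_of {c *\<^sub>C (T ^^ n) f |c n. True} = UNIV"
    using assms(3) by (auto simp: weakly_supercyclic_def)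
  have lim: "(\<lambda>n. u ((T ^^ n) e)) \<longlonglongrightarrow> v e" for e
    using tendsto_if_limitin_dual_weak_topology[OF assms(7)] by (simp add: dual_map_funpow)
  \<comment> \<open>One sequence has both limits: it is the orbit of \<open>T e\<close>, and also
    the orbit of \<open>e\<close> shifted by one index.\<close>
  have v_fixed: "v (T e) = v e" for e
  proof (rule LIMSEQ_unique)
    show "(\<lambda>n. u ((T ^^ n) (T e))) \<longlonglongrightarrow> v (T e)"
      by (rule lim)
    show "(\<lambda>n. u ((T ^^ n) (T e))) \<longlonglongrightarrow> v e"
      using LIMSEQ_Suc[OF lim[of e]] by (simp add: funpow_swap1)
  qed
  have v_orbit: "v ((T ^^ n) f) = v f" for n
    by (induction n) (simp_all add: v_fixed)
  have vf: "v f \<noteq> 0"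
  proof
    assume "v f = 0"
    \<comment> \<open>The density lemma with \<open>v\<close> in both roles and \<open>M = 0\<close>
      spreads the vanishing of \<open>v\<close> from the projective orbit to the whole
      space.\<close>
    have "norm (v x) \<le> 0 * norm (v x)" for x
      by (rule norm_le_on_weakly_dense[OF assms(6) assms(6) dense])
        (auto simp: topological_dual_scaleC[OF assms(6)] v_orbit \<open>v f = 0\<close>)
    then show False
      using v_nonzero by auto
  qed
  obtain K where K: "\<And>n. norm (u ((T ^^ n) f)) \<le> K"
    using lim[of f, THEN convergentI, THEN convergent_imp_Bseq] by (auto simp: Bseq_def)
  \<comment> \<open>At \<open>c *\<^sub>C (T ^^ n) f\<close> the right-hand side is
    \<open>norm c * K\<close>, since \<open>v\<close> is constant along the orbit of
    \<open>f\<close>; this fixes the constant.\<close>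
  have dominated: "norm (u x) \<le> K / norm (v f) * norm (v x)" for x
  proof (rule norm_le_on_weakly_dense[OF assms(4,6) dense])
    fix y assume "y \<in> {c *\<^sub>C (T ^^ n) f |c n. True}"
    then obtain c n where y: "y = c *\<^sub>C (T ^^ n) f"
      by blast
    have "norm (u y) = norm c * norm (u ((T ^^ n) f))"
      by (simp add: y topological_dual_scaleC[OF assms(4)] norm_mult)
    also have "\<dots> \<le> norm c * K"
      using K by (rule mult_left_mono) simp
    also have "\<dots> = K / norm (v f) * norm (v y)"
      using vf by (simp add: y topological_dual_scaleC[OF assms(6)] v_orbit norm_mult)
    finally show "norm (u y) \<le> K / norm (v f) * norm (v y)" .
  qed
  \<comment> \<open>At \<open>T e - e\<close> the bound is zero because \<open>v\<close> is
    fixed.\<close>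
  have "u (T e) = u e" for e
    using dominated[of "T e - e"]
    by (simp add: topological_dual_diff[OF assms(4)] topological_dual_diff[OF assms(6)] v_fixed)
  then show False
    using assms(5) by (auto simp: dual_map_def)
qed

end
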